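(* Let $(\Xi,\rho,\theta,\Sigma)$ be a continuous groupoid action with $\Xi$ strongly non-compact. For a point $\sigma\in\Sigma$ consider the following five conditions: (a) $\mathfrak O_\sigma\cap\mathfrak L_\sigma\neq\emptyset$; (b) $\mathfrak L_\sigma=\overline{\mathfrak O}_\sigma$; (c) $\sigma\in\mathfrak L_\sigma$; (d) there is a divergent net $(\xi_i)_{i\in I}\subset\Xi_{\rho(\sigma)}$ such that $\xi_i\bullet\sigma\to\sigma$; (e) $\widetilde\Xi_\sigma^U$ is not relatively compact for any open neighborhood $U$ of $\sigma$. Then $(b)\Rightarrow(c)\Leftrightarrow(d)\Leftrightarrow(e)\Rightarrow(a)$. If $\Xi$ is open and locally compact, the five conditions are equivalent.
   Context: All topological spaces are Hausdorff. A groupoid $\Xi$ is a small category in which all arrows are invertible; $X=\Xi^{(0)}$ is its unit space, $d,r:\Xi\to X$ are the source and range maps, and $\xi\eta$ is defined iff $d(\xi)=r(\eta)$. A topological groupoid is a groupoid with a (Hausdorff) topology making inversion and multiplication continuous (composable pairs carry the topology induced from $\Xi\times\Xi$); $X$ has the subspace topology. $\Xi$ is called open if $d:\Xi\to X$ is an open map. For $x\in X$, $\Xi_x=d^{-1}(\{x\})$. $\Xi$ is strongly non-compact if $\Xi_x$ is non-compact for every $x\in X$. A continuous groupoid action $(\Xi,\rho,\theta,\Sigma)$ consists of a topological groupoid $\Xi$, a Hausdorff space $\Sigma$, a continuous surjection $\rho:\Sigma\to X$ (the anchor) and a continuous map $\theta:\{(\xi,\sigma)\in\Xi\times\Sigma: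 d(\xi)=\rho(\sigma)\}\to\Sigma$, $\theta_\xi(\sigma)=\xi\bullet\sigma$, with $\rho(\sigma)\bullet\sigma=\sigma$ and: if $d(\xi)=r(\eta)$ and $d(\eta)=\rho(\sigma)$ then $d(\xi)=\rho(\eta\bullet\sigma)$ and $(\xi\eta)\bullet\sigma=\xi\bullet(\eta\bullet\sigma)$. For $\mathsf A\subset\Xi$: $\mathsf A\bullet\sigma=\{\xi\bullet\sigma:\xi\in\mathsf A,\ d(\xi)=\rho(\sigma)\}$. The orbit of $\sigma$ is $\mathfrak O_\sigma=\Xi_{\rho(\sigma)}\bullet\sigma$, with closure $\overline{\mathfrak O}_\sigma$. The limit set of $\sigma$ is $\mathfrak L_\sigma=\bigcap_{\mathsf K}\overline{(\Xi\setminus\mathsf K)\bullet\sigma}$, the intersection being over all compact subsets $\mathsf K$ of $\Xi$. For $U\subset\Sigma$, $\widetilde\Xi_\sigma^U=\{\xi\in\Xi_{\rho(\sigma)}:\xi\bullet\sigma\in U\}$. A net $(\xi_i)_{i\in I}$ in $\Xi_x$ is divergent if for every compact $\mathsf k\subset\Xi_x$ there is $i_{\mathsf k}\in I$ with $\xi_i\notin\mathsf k$ for all $i\geq i_{\mathsf k}$. Relatively compact means having compact closure. *)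

theory Defs
  imports "HOL-Analysis.Analysis"
begin

text \<open>Spaces are abstract topologies with explicit carriers. A groupoid is given by its arrows
  only: the objects are identified with the identity arrows, so the unit space is a subset of the
  space of arrows. The functions are only meaningful on the carriers.\<close>

record 'g groupoid_data =
  arrows :: "'g topology"
  src :: "'g \<Rightarrow> 'g"
  rng :: "'g \<Rightarrow> 'g"
  mult :: "'g \<Rightarrow> 'g \<Rightarrow> 'g"
  invs :: "'g \<Rightarrow> 'g"

record ('g, 's) action_data = "'g groupoid_data" +
  phase :: "'s topology"
  anchor :: "'s \<Rightarrow> 'g"
  act :: "'g \<Rightarrow> 's \<Rightarrow> 's"

definition units :: "('g, 'm) groupoid_data_scheme \<Rightarrow> 'g set" where
  "units G = {x \<in> topspace (arrows G). src G x = x}"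

locale groupoid =
  fixes G :: "('g, 'm) groupoid_data_scheme" (structure)
  assumes src_closed: "\<xi> \<in> topspace (arrows G) \<Longrightarrow> src G \<xi> \<in> topspace (arrows G)"
    and rng_closed: "\<xi> \<in> topspace (arrows G) \<Longrightarrow> rng G \<xi> \<in> topspace (arrows G)"
    and src_src: "\<xi> \<in> topspace (arrows G) \<Longrightarrow> src G (src G \<xi>) = src G \<xi>"
    and rng_src: "\<xi> \<in> topspace (arrows G) \<Longrightarrow> rng G (src G \<xi>) = src G \<xi>"
    and src_rng: "\<xi> \<in> topspace (arrows G) \<Longrightarrow> src G (rng G \<xi>) = rng G \<xi>"
    and rng_rng: "\<xi> \<in> topspace (arrows G) \<Longrightarrow> rng G (rng G \<xi>) = rng G \<xi>"
    and mult_closed: "\<lbrakk>\<xi> \<in> topspace (arrows G); \<eta> \<in> topspace (arrows G); src G \<xi> = rng G \<eta>\<rbrakk>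
      \<Longrightarrow> mult G \<xi> \<eta> \<in> topspace (arrows G)"
    and src_mult: "\<lbrakk>\<xi> \<in> topspace (arrows G); \<eta> \<in> topspace (arrows G); src G \<xi> = rng G \<eta>\<rbrakk>
      \<Longrightarrow> src G (mult G \<xi> \<eta>) = src G \<eta>"
    and rng_mult: "\<lbrakk>\<xi> \<in> topspace (arrows G); \<eta> \<in> topspace (arrows G); src G \<xi> = rng G \<eta>\<rbrakk>
      \<Longrightarrow> rng G (mult G \<xi> \<eta>) = rng G \<xi>"
    and mult_assoc: "\<lbrakk>\<xi> \<in> topspace (arrows G); \<eta> \<in> topspace (arrows G); \<zeta> \<in> topspace (arrows G);
        src G \<xi> = rng G \<eta>; src G \<eta> = rng G \<zeta>\<rbrakk>
      \<Longrightarrow> mult G (mult G \<xi> \<eta>) \<zeta> = mult G \<xi> (mult G \<eta> \<zeta>)"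
    and mult_src: "\<xi> \<in> topspace (arrows G) \<Longrightarrow> mult G \<xi> (src G \<xi>) = \<xi>"
    and rng_mult_left: "\<xi> \<in> topspace (arrows G) \<Longrightarrow> mult G (rng G \<xi>) \<xi> = \<xi>"
    and inv_closed: "\<xi> \<in> topspace (arrows G) \<Longrightarrow> invs G \<xi> \<in> topspace (arrows G)"
    and src_inv: "\<xi> \<in> topspace (arrows G) \<Longrightarrow> src G (invs G \<xi>) = rng G \<xi>"
    and rng_inv: "\<xi> \<in> topspace (arrows G) \<Longrightarrow> rng G (invs G \<xi>) = src G \<xi>"
    and inv_mult: "\<xi> \<in> topspace (arrows G) \<Longrightarrow> mult G (invs G \<xi>) \<xi> = src G \<xi>"
    and mult_inv: "\<xi> \<in> topspace (arrows G) \<Longrightarrow> mult G \<xi> (invs G \<xi>) = rng G \<xi>"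

text \<open>Continuity of \<open>src\<close> and \<open>rng\<close> is not assumed: it follows, since
  \<open>src \<xi> = \<xi>\<inverse>\<xi>\<close> and \<open>rng \<xi> = \<xi>\<xi>\<inverse>\<close>.\<close>

locale topological_groupoid = groupoid +
  assumes Hausdorff_arrows: "Hausdorff_space (arrows G)"
    and continuous_inv: "continuous_map (arrows G) (arrows G) (invs G)"
    and continuous_mult:
      "continuous_map
         (subtopology (prod_topology (arrows G) (arrows G)) {(\<xi>, \<eta>). src G \<xi> = rng G \<eta>})
         (arrows G) (\<lambda>(\<xi>, \<eta>). mult G \<xi> \<eta>)"

locale continuous_groupoid_action = topological_groupoid A
  for A :: "('g, 's, 'm) action_data_scheme" (structure) +
  assumes Hausdorff_phase: "Hausdorff_space (phase A)"
    and continuous_anchor: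
      "continuous_map (phase A) (subtopology (arrows A) (units A)) (anchor A)"
    and anchor_surj: "anchor A ` topspace (phase A) = units A"
    and continuous_act:
      "continuous_map
         (subtopology (prod_topology (arrows A) (phase A)) {(\<xi>, \<sigma>). src A \<xi> = anchor A \<sigma>})
         (phase A) (\<lambda>(\<xi>, \<sigma>). act A \<xi> \<sigma>)"
    and act_unit: "\<sigma> \<in> topspace (phase A) \<Longrightarrow> act A (anchor A \<sigma>) \<sigma> = \<sigma>"
    and anchor_act: "\<lbrakk>\<xi> \<in> topspace (arrows A); \<eta> \<in> topspace (arrows A); \<sigma> \<in> topspace (phase A);
        src A \<xi> = rng A \<eta>; src A \<eta> = anchor A \<sigma>\<rbrakk>
      \<Longrightarrow> src A \<xi> = anchor A (act A \<eta> \<sigma>)"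
    and act_mult: "\<lbrakk>\<xi> \<in> topspace (arrows A); \<eta> \<in> topspace (arrows A); \<sigma> \<in> topspace (phase A);
        src A \<xi> = rng A \<eta>; src A \<eta> = anchor A \<sigma>\<rbrakk>
      \<Longrightarrow> act A (mult A \<xi> \<eta>) \<sigma> = act A \<xi> (act A \<eta> \<sigma>)"

definition open_groupoid :: "('g, 'm) groupoid_data_scheme \<Rightarrow> bool" where
  "open_groupoid G \<longleftrightarrow> open_map (arrows G) (subtopology (arrows G) (units G)) (src G)"

definition src_fibre :: "('g, 'm) groupoid_data_scheme \<Rightarrow> 'g \<Rightarrow> 'g set" where
  "src_fibre G x = {\<xi> \<in> topspace (arrows G). src G \<xi> = x}"

definition strongly_noncompact :: "('g, 'm) groupoid_data_scheme \<Rightarrow> bool" where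
  "strongly_noncompact G \<longleftrightarrow> (\<forall>x\<in>units G. \<not> compactin (arrows G) (src_fibre G x))"

definition act_set :: "('g, 's, 'm) action_data_scheme \<Rightarrow> 'g set \<Rightarrow> 's \<Rightarrow> 's set" where
  "act_set A B \<sigma> = {act A \<xi> \<sigma> | \<xi>. \<xi> \<in> B \<and> src A \<xi> = anchor A \<sigma>}"

definition orbit :: "('g, 's, 'm) action_data_scheme \<Rightarrow> 's \<Rightarrow> 's set" where
  "orbit A \<sigma> = act_set A (src_fibre A (anchor A \<sigma>)) \<sigma>"

definition limit_set :: "('g, 's, 'm) action_data_scheme \<Rightarrow> 's \<Rightarrow> 's set" where
  "limit_set A \<sigma> =
     (\<Inter>K\<in>{K. compactin (arrows A) K}. phase A closure_of act_set A (topspace (arrows A) - K) \<sigma>)"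

definition return_set :: "('g, 's, 'm) action_data_scheme \<Rightarrow> 's \<Rightarrow> 's set \<Rightarrow> 'g set" where
  "return_set A \<sigma> U = {\<xi> \<in> src_fibre A (anchor A \<sigma>). act A \<xi> \<sigma> \<in> U}"

text \<open>The closure may be taken in the space of all arrows: source fibres are closed in it.\<close>

definition relatively_compactin :: "'a topology \<Rightarrow> 'a set \<Rightarrow> bool" where
  "relatively_compactin T S \<longleftrightarrow> S \<subseteq> topspace T \<and> compactin T (T closure_of S)"

definition directed_set :: "'i set \<Rightarrow> 'i rel \<Rightarrow> bool" where
  "directed_set I R \<longleftrightarrow>
     I \<noteq> {} \<and> preorder_on I R \<and> (\<forall>i\<in>I. \<forall>j\<in>I. \<exists>k\<in>I. (i, k) \<in> R \<and> (j, k) \<in> R)"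

text \<open>\<open>(i, j) \<in> R\<close> means that \<open>j\<close> lies beyond \<open>i\<close>.\<close>

definition net_eventually :: "'i set \<Rightarrow> 'i rel \<Rightarrow> ('i \<Rightarrow> bool) \<Rightarrow> bool" where
  "net_eventually I R P \<longleftrightarrow> (\<exists>i\<^sub>0\<in>I. \<forall>i\<in>I. (i\<^sub>0, i) \<in> R \<longrightarrow> P i)"

definition net_converges :: "'a topology \<Rightarrow> 'i set \<Rightarrow> 'i rel \<Rightarrow> ('i \<Rightarrow> 'a) \<Rightarrow> 'a \<Rightarrow> bool" where
  "net_converges T I R f l \<longleftrightarrow>
     l \<in> topspace T \<and> (\<forall>U. openin T U \<and> l \<in> U \<longrightarrow> net_eventually I R (\<lambda>i. f i \<in> U))"

definition divergent_net ::
    "('g, 'm) groupoid_data_scheme \<Rightarrow> 'g \<Rightarrow> 'i set \<Rightarrow> 'i rel \<Rightarrow> ('i \<Rightarrow> 'g) \<Rightarrow> bool" where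
  "divergent_net G x I R \<xi> \<longleftrightarrow>
     \<xi> ` I \<subseteq> src_fibre G x \<and>
     (\<forall>k. k \<subseteq> src_fibre G x \<and> compactin (arrows G) k \<longrightarrow> net_eventually I R (\<lambda>i. \<xi> i \<notin> k))"

text \<open>HOL cannot quantify over the type of the indices of a net, so this type is a parameter of
  the following condition.\<close>

definition divergent_return_net ::
    "('g, 's, 'm) action_data_scheme \<Rightarrow> 's \<Rightarrow> 'i itself \<Rightarrow> bool" where
  "divergent_return_net A \<sigma> (_ :: 'i itself) \<longleftrightarrow>
     (\<exists>(I :: 'i set) R \<xi>. directed_set I R \<and> divergent_net A (anchor A \<sigma>) I R \<xi> \<and>
        net_converges (phase A) I R (\<lambda>i. act A (\<xi> i) \<sigma>) \<sigma>)"

end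

theory Submission
  imports Defs
begin

text \<open>
  Unfolding the closures in the definition of the limit set gives a recurrence criterion: a point
  \<open>\<tau>\<close> lies in the limit set of \<open>\<sigma>\<close> iff for every neighbourhood \<open>U\<close> of \<open>\<tau>\<close> and every compact
  set \<open>K\<close> of arrows, some arrow outside \<open>K\<close> moves \<open>\<sigma>\<close> into \<open>U\<close> (\<open>in_limit_set_iff\<close>). Taken at
  \<open>\<tau> = \<sigma>\<close>, this says that no compact set contains the return set of a neighbourhood, which is the
  condition on return sets; and choosing one such arrow for each pair \<open>(K, U)\<close> gives a divergent
  net that brings \<open>\<sigma>\<close> back to itself. A divergent net in turn leaves the closure of a relatively
  compact return set, because source fibres are closed and so contain this closure. The
  implications from the equality with the orbit closure and to the intersection with the orbit
  hold because \<open>\<sigma>\<close> belongs to its own orbit.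

  The way back rests on the invariance of the limit set (\<open>act_in_limit_set\<close>), which is where
  openness and local compactness enter. If the limit set meets the orbit, invariance
  makes it contain the whole orbit; being closed and always contained in the orbit closure, it is
  then equal to the orbit closure.
\<close>

section \<open>Topological groupoids\<close>

lemma (in topological_groupoid) continuous_map_src:
  "continuous_map (arrows G) (arrows G) (src G)"
proof -
  have "continuous_map (arrows G)
      (subtopology (prod_topology (arrows G) (arrows G)) {(\<xi>, \<eta>). src G \<xi> = rng G \<eta>})
      (\<lambda>\<xi>. (invs G \<xi>, \<xi>))"
    using continuous_inv
    by (auto simp: continuous_map_in_subtopology continuous_map_pairedI src_inv)
  from continuous_map_compose[OF this continuous_mult]
  have "continuous_map (arrows G) (arrows G) (\<lambda>\<xi>. mult G (invs G \<xi>) \<xi>)"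
    by (simp add: o_def)
  then show ?thesis
    by (rule continuous_map_eq) (simp add: inv_mult)
qed

lemma (in topological_groupoid) continuous_map_rng:
  "continuous_map (arrows G) (arrows G) (rng G)"
proof -
  have "continuous_map (arrows G) (arrows G) (\<lambda>\<xi>. src G (invs G \<xi>))"
    using continuous_map_compose[OF continuous_inv continuous_map_src] by (simp add: o_def)
  then show ?thesis
    by (rule continuous_map_eq) (simp add: src_inv)
qed

lemma (in topological_groupoid) closedin_src_fibre:
  assumes "x \<in> topspace (arrows G)"
  shows "closedin (arrows G) (src_fibre G x)"
proof -
  have "closedin (arrows G) {x}"
    using assms Hausdorff_arrows by (simp add: closedin_Hausdorff_singleton)
  from closedin_continuous_map_preimage[OF continuous_map_src this] show ?thesis
    by (simp add: src_fibre_def)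
qed

text \<open>Composability is an equation between continuous maps into a Hausdorff space, so it cuts a
  closed, hence compact, subset out of \<open>K \<times> L\<close>; the multiplication is continuous there.\<close>

lemma (in topological_groupoid) compactin_products:
  assumes "compactin (arrows G) K" and "compactin (arrows G) L"
  shows "compactin (arrows G) {mult G \<xi> \<eta> | \<xi> \<eta>. \<xi> \<in> K \<and> \<eta> \<in> L \<and> src G \<xi> = rng G \<eta>}"
proof -
  let ?P = "prod_topology (arrows G) (arrows G)"
  let ?C = "{(\<xi>, \<eta>). src G \<xi> = rng G \<eta>}"
  have "closedin ?P {p \<in> topspace ?P. src G (fst p) = rng G (snd p)}"
  proof (rule closedin_continuous_maps_eq[OF Hausdorff_arrows])
    show "continuous_map ?P (arrows G) (\<lambda>p. src G (fst p))"
      using continuous_map_compose[OF continuous_map_fst continuous_map_src]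
      by (simp add: o_def)
    show "continuous_map ?P (arrows G) (\<lambda>p. rng G (snd p))"
      using continuous_map_compose[OF continuous_map_snd continuous_map_rng]
      by (simp add: o_def)
  qed
  moreover have "compactin ?P (K \<times> L)"
    using assms by (simp add: compactin_Times)
  ultimately have "compactin ?P
      ({p \<in> topspace ?P. src G (fst p) = rng G (snd p)} \<inter> K \<times> L)"
    by (rule closed_Int_compactin)
  moreover have "{p \<in> topspace ?P. src G (fst p) = rng G (snd p)} \<inter> K \<times> L = ?C \<inter> K \<times> L"
    using assms[THEN compactin_subset_topspace] by auto
  ultimately have "compactin (subtopology ?P ?C) (?C \<inter> K \<times> L)"
    by (simp add: compactin_subtopology)
  from image_compactin[OF this continuous_mult]
  have "compactin (arrows G) ((\<lambda>(\<xi>, \<eta>). mult G \<xi> \<eta>) ` (?C \<inter> K \<times> L))" .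
  moreover have "(\<lambda>(\<xi>, \<eta>). mult G \<xi> \<eta>) ` (?C \<inter> K \<times> L)
      = {mult G \<xi> \<eta> | \<xi> \<eta>. \<xi> \<in> K \<and> \<eta> \<in> L \<and> src G \<xi> = rng G \<eta>}"
    by force
  ultimately show ?thesis
    by simp
qed

section \<open>Orbits and limit sets\<close>

lemma (in continuous_groupoid_action) anchor_in_units:
  "\<sigma> \<in> topspace (phase A) \<Longrightarrow> anchor A \<sigma> \<in> units A"
  using anchor_surj by blast

lemma (in continuous_groupoid_action) anchor_in_arrows:
  "\<sigma> \<in> topspace (phase A) \<Longrightarrow> anchor A \<sigma> \<in> topspace (arrows A)"
  using anchor_in_units by (auto simp: units_def)

lemma (in continuous_groupoid_action) anchor_in_src_fibre:
  "\<sigma> \<in> topspace (phase A) \<Longrightarrow> anchor A \<sigma> \<in> src_fibre A (anchor A \<sigma>)"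
  using anchor_in_units by (auto simp: units_def src_fibre_def)

lemma (in continuous_groupoid_action) act_closed:
  assumes "\<xi> \<in> src_fibre A (anchor A \<sigma>)" and "\<sigma> \<in> topspace (phase A)"
  shows "act A \<xi> \<sigma> \<in> topspace (phase A)"
proof -
  have "(\<xi>, \<sigma>) \<in> topspace (subtopology (prod_topology (arrows A) (phase A))
      {(\<xi>, \<sigma>). src A \<xi> = anchor A \<sigma>})"
    using assms by (simp add: src_fibre_def)
  from continuous_map_image_subset_topspace[OF continuous_act, THEN subsetD, OF imageI, OF this]
  show ?thesis
    by simp
qed

lemma (in continuous_groupoid_action) anchor_act_eq_rng:
  assumes "\<xi> \<in> src_fibre A (anchor A \<sigma>)" and "\<sigma> \<in> topspace (phase A)"
  shows "anchor A (act A \<xi> \<sigma>) = rng A \<xi>"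
  using anchor_act[of "rng A \<xi>" \<xi> \<sigma>] assms
  by (simp add: src_fibre_def rng_closed src_rng)

lemma (in continuous_groupoid_action) self_in_orbit:
  assumes "\<sigma> \<in> topspace (phase A)"
  shows "\<sigma> \<in> orbit A \<sigma>"
proof -
  have "\<sigma> = act A (anchor A \<sigma>) \<sigma>"
    using assms by (simp add: act_unit)
  then show ?thesis
    using anchor_in_src_fibre[OF assms] unfolding orbit_def act_set_def src_fibre_def by blast
qed

lemma orbit_eq: "orbit A \<sigma> = (\<lambda>\<xi>. act A \<xi> \<sigma>) ` src_fibre A (anchor A \<sigma>)"
  by (auto simp: orbit_def act_set_def src_fibre_def)

text \<open>Taking \<open>K\<close> empty shows that the intersection defining the limit set is over a nonempty
  family, so that its elements are points of the space.\<close>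

lemma in_limit_set_iff:
  "\<tau> \<in> limit_set A \<sigma> \<longleftrightarrow> \<tau> \<in> topspace (phase A) \<and>
     (\<forall>K U. compactin (arrows A) K \<and> openin (phase A) U \<and> \<tau> \<in> U \<longrightarrow>
        (\<exists>\<xi>\<in>src_fibre A (anchor A \<sigma>) - K. act A \<xi> \<sigma> \<in> U))"
proof -
  have "compactin (arrows A) {}"
    by simp
  then have "\<tau> \<in> limit_set A \<sigma> \<longleftrightarrow> \<tau> \<in> topspace (phase A) \<and>
      (\<forall>K. compactin (arrows A) K \<longrightarrow>
        (\<forall>U. \<tau> \<in> U \<and> openin (phase A) U \<longrightarrow>
          (\<exists>\<omega>. \<omega> \<in> act_set A (topspace (arrows A) - K) \<sigma> \<and> \<omega> \<in> U)))"
    unfolding limit_set_def in_closure_of INT_iff Ball_def mem_Collect_eq by blast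
  moreover have "(\<exists>\<omega>. \<omega> \<in> act_set A (topspace (arrows A) - K) \<sigma> \<and> \<omega> \<in> U) \<longleftrightarrow>
      (\<exists>\<xi>\<in>src_fibre A (anchor A \<sigma>) - K. act A \<xi> \<sigma> \<in> U)" for K U
    unfolding act_set_def src_fibre_def by blast
  ultimately show ?thesis
    by auto
qed

lemma closedin_limit_set: "closedin (phase A) (limit_set A \<sigma>)"
proof -
  have "compactin (arrows A) {}"
    by simp
  then show ?thesis
    unfolding limit_set_def by (intro closedin_Inter) auto
qed

lemma limit_set_subset_closure_orbit: "limit_set A \<sigma> \<subseteq> phase A closure_of orbit A \<sigma>"
proof
  fix \<tau>
  assume L: "\<tau> \<in> limit_set A \<sigma>"
  have "compactin (arrows A) {}"
    by simp
  with L show "\<tau> \<in> phase A closure_of orbit A \<sigma>"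
    unfolding in_limit_set_iff orbit_eq in_closure_of by blast
qed

text \<open>
  To bring \<open>\<sigma>\<close> close to \<open>\<eta>\<bullet>\<tau>\<close> along arrows outside \<open>K\<close>, bring it close to \<open>\<tau>\<close> by an arrow \<open>\<xi>\<close>
  and continue by an arrow \<open>\<nu>\<close> close to \<open>\<eta>\<close>. The orbit point \<open>\<xi>\<bullet>\<sigma>\<close> has in general another anchor
  than \<open>\<tau>\<close>, so that \<open>\<eta>\<close> itself need not act on it; openness of the source map provides a
  composable \<open>\<nu>\<close>. The product \<open>\<nu>\<xi>\<close> avoids \<open>K\<close> if \<open>\<xi>\<close> avoids \<open>M\<inverse>K\<close>, where \<open>M\<close> is a compact
  neighbourhood of \<open>\<eta>\<close>.
\<close>

lemma (in continuous_groupoid_action) act_in_limit_set: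
  assumes "open_groupoid A" and "locally_compact_space (arrows A)"
    and \<sigma>: "\<sigma> \<in> topspace (phase A)"
    and L: "\<tau> \<in> limit_set A \<sigma>"
    and \<eta>: "\<eta> \<in> src_fibre A (anchor A \<tau>)"
  shows "act A \<eta> \<tau> \<in> limit_set A \<sigma>"
  unfolding in_limit_set_iff
proof (intro conjI allI impI)
  have \<tau>: "\<tau> \<in> topspace (phase A)"
    using L by (simp add: in_limit_set_iff)
  show "act A \<eta> \<tau> \<in> topspace (phase A)"
    using act_closed[OF \<eta> \<tau>] .
  have \<eta>_arrow: "\<eta> \<in> topspace (arrows A)" and src_\<eta>: "src A \<eta> = anchor A \<tau>"
    using \<eta> by (auto simp: src_fibre_def)
  fix K V
  assume "compactin (arrows A) K \<and> openin (phase A) V \<and> act A \<eta> \<tau> \<in> V"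
  then have K: "compactin (arrows A) K" and V: "openin (phase A) V" and \<eta>\<tau>: "act A \<eta> \<tau> \<in> V"
    by auto
  let ?P = "prod_topology (arrows A) (phase A)"
  let ?C = "{(\<xi>, \<sigma>). src A \<xi> = anchor A \<sigma>}"
  have "openin (subtopology ?P ?C)
      {p \<in> topspace (subtopology ?P ?C). (\<lambda>(\<xi>, \<sigma>). act A \<xi> \<sigma>) p \<in> V}"
    using openin_continuous_map_preimage[OF continuous_act V] .
  then obtain T where T: "openin ?P T"
    and T_eq: "{p \<in> topspace (subtopology ?P ?C). (\<lambda>(\<xi>, \<sigma>). act A \<xi> \<sigma>) p \<in> V} = T \<inter> ?C"
    unfolding openin_subtopology by blast
  have "(\<eta>, \<tau>) \<in> T"
    using T_eq \<eta>_arrow src_\<eta> \<tau> \<eta>\<tau> by fastforce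
  then obtain N\<^sub>0 W\<^sub>0 where N\<^sub>0: "openin (arrows A) N\<^sub>0" "\<eta> \<in> N\<^sub>0"
    and W\<^sub>0: "openin (phase A) W\<^sub>0" "\<tau> \<in> W\<^sub>0" and box: "N\<^sub>0 \<times> W\<^sub>0 \<subseteq> T"
    using T[unfolded openin_prod_topology_alt, rule_format, OF \<open>(\<eta>, \<tau>) \<in> T\<close>] by metis
  have act_box: "act A \<nu> \<omega> \<in> V"
    if "\<nu> \<in> N\<^sub>0" "\<omega> \<in> W\<^sub>0" "src A \<nu> = anchor A \<omega>" for \<nu> \<omega>
  proof -
    have "(\<nu>, \<omega>) \<in> T \<inter> ?C"
      using that box by auto
    then show ?thesis
      unfolding T_eq[symmetric] by simp
  qed
  obtain N\<^sub>1 M where N\<^sub>1: "openin (arrows A) N\<^sub>1" "\<eta> \<in> N\<^sub>1" "N\<^sub>1 \<subseteq> M"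
    and M: "compactin (arrows A) M"
    using assms(2)[unfolded locally_compact_space_def, rule_format, OF \<eta>_arrow] by metis
  define N where "N = N\<^sub>0 \<inter> N\<^sub>1"
  have N: "openin (arrows A) N" "\<eta> \<in> N"
    using N\<^sub>0 N\<^sub>1 by (auto simp: N_def)
  have "openin (subtopology (arrows A) (units A)) (src A ` N)"
    using assms(1) N(1) by (simp add: open_groupoid_def open_map_def)
  from openin_continuous_map_preimage[OF continuous_anchor this]
  have "openin (phase A) {\<omega> \<in> topspace (phase A). anchor A \<omega> \<in> src A ` N}" .
  define W where "W = W\<^sub>0 \<inter> {\<omega> \<in> topspace (phase A). anchor A \<omega> \<in> src A ` N}"
  have "anchor A \<tau> \<in> src A ` N"
    using N(2) src_\<eta> by (metis imageI)
  then have W: "openin (phase A) W" "\<tau> \<in> W"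
    unfolding W_def
    using W\<^sub>0 \<open>openin (phase A) {\<omega> \<in> _. _}\<close> \<tau> by auto
  define Q where
    "Q = {mult A \<mu> \<kappa> | \<mu> \<kappa>. \<mu> \<in> invs A ` M \<and> \<kappa> \<in> K \<and> src A \<mu> = rng A \<kappa>}"
  have "compactin (arrows A) Q"
    unfolding Q_def by (intro compactin_products image_compactin[OF M continuous_inv] K)
  then obtain \<xi> where \<xi>: "\<xi> \<in> src_fibre A (anchor A \<sigma>)" and "\<xi> \<notin> Q" and \<xi>\<sigma>: "act A \<xi> \<sigma> \<in> W"
    using L W unfolding in_limit_set_iff by blast
  obtain \<nu> where \<nu>: "\<nu> \<in> N" and "src A \<nu> = anchor A (act A \<xi> \<sigma>)"
    using \<xi>\<sigma> by (auto simp: W_def)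
  then have src_\<nu>: "src A \<nu> = rng A \<xi>"
    using anchor_act_eq_rng[OF \<xi> \<sigma>] by simp
  have \<nu>_arrow: "\<nu> \<in> topspace (arrows A)"
    using \<nu> N(1) openin_subset by blast
  have \<xi>_arrow: "\<xi> \<in> topspace (arrows A)" and src_\<xi>: "src A \<xi> = anchor A \<sigma>"
    using \<xi> by (auto simp: src_fibre_def)
  have "act A (mult A \<nu> \<xi>) \<sigma> = act A \<nu> (act A \<xi> \<sigma>)"
    using act_mult[OF \<nu>_arrow \<xi>_arrow \<sigma> src_\<nu> src_\<xi>] .
  also have "\<dots> \<in> V"
    using \<nu> \<xi>\<sigma> \<open>src A \<nu> = anchor A (act A \<xi> \<sigma>)\<close> by (intro act_box) (auto simp: N_def W_def)
  finally have "act A (mult A \<nu> \<xi>) \<sigma> \<in> V" .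
  moreover have "mult A \<nu> \<xi> \<in> src_fibre A (anchor A \<sigma>)"
    using \<nu>_arrow \<xi>_arrow src_\<nu> src_\<xi> by (simp add: src_fibre_def mult_closed src_mult)
  moreover have "mult A \<nu> \<xi> \<notin> K"
  proof
    assume "mult A \<nu> \<xi> \<in> K"
    moreover have "mult A (invs A \<nu>) (mult A \<nu> \<xi>) = \<xi>"
      using mult_assoc[of "invs A \<nu>" \<nu> \<xi>] \<nu>_arrow \<xi>_arrow src_\<nu>
      by (simp add: inv_closed src_inv inv_mult rng_mult_left)
    moreover have "src A (invs A \<nu>) = rng A (mult A \<nu> \<xi>)"
      using \<nu>_arrow \<xi>_arrow src_\<nu> by (simp add: src_inv rng_mult)
    moreover have "invs A \<nu> \<in> invs A ` M"
      using \<nu> N\<^sub>1(3) by (auto simp: N_def)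
    ultimately have "\<xi> \<in> Q"
      unfolding Q_def by (metis (mono_tags, lifting) mem_Collect_eq)
    with \<open>\<xi> \<notin> Q\<close> show False ..
  qed
  ultimately show "\<exists>\<xi>\<in>src_fibre A (anchor A \<sigma>) - K. act A \<xi> \<sigma> \<in> V"
    by blast
qed

lemma (in continuous_groupoid_action) limit_set_eq_closure_orbit:
  assumes G: "open_groupoid A" "locally_compact_space (arrows A)"
    and \<sigma>: "\<sigma> \<in> topspace (phase A)"
    and "orbit A \<sigma> \<inter> limit_set A \<sigma> \<noteq> {}"
  shows "limit_set A \<sigma> = phase A closure_of orbit A \<sigma>"
proof -
  obtain \<zeta> where \<zeta>: "\<zeta> \<in> src_fibre A (anchor A \<sigma>)" and L: "act A \<zeta> \<sigma> \<in> limit_set A \<sigma>"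
    using assms(4) by (auto simp: orbit_eq)
  have \<zeta>_arrow: "\<zeta> \<in> topspace (arrows A)" and src_\<zeta>: "src A \<zeta> = anchor A \<sigma>"
    using \<zeta> by (auto simp: src_fibre_def)
  have "orbit A \<sigma> \<subseteq> limit_set A \<sigma>"
  proof
    fix \<tau>
    assume "\<tau> \<in> orbit A \<sigma>"
    then obtain \<xi> where \<xi>: "\<xi> \<in> src_fibre A (anchor A \<sigma>)" and \<tau>: "\<tau> = act A \<xi> \<sigma>"
      by (auto simp: orbit_eq)
    have \<xi>_arrow: "\<xi> \<in> topspace (arrows A)" and src_\<xi>: "src A \<xi> = anchor A \<sigma>"
      using \<xi> by (auto simp: src_fibre_def)
    \<comment> \<open>The arrow \<open>\<xi>\<zeta>\<inverse>\<close> moves the point \<open>\<zeta>\<bullet>\<sigma>\<close> of the limit set to \<open>\<xi>\<bullet>\<sigma>\<close>.\<close>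
    let ?\<eta> = "mult A \<xi> (invs A \<zeta>)"
    have \<eta>_arrow: "?\<eta> \<in> topspace (arrows A)" and src_\<eta>: "src A ?\<eta> = rng A \<zeta>"
      using \<xi>_arrow \<zeta>_arrow src_\<xi> src_\<zeta>
      by (simp_all add: mult_closed inv_closed rng_inv src_mult src_inv)
    have "mult A ?\<eta> \<zeta> = \<xi>"
      using mult_assoc[of \<xi> "invs A \<zeta>" \<zeta>] \<xi>_arrow \<zeta>_arrow src_\<xi> src_\<zeta> mult_src[OF \<xi>_arrow]
      by (simp add: inv_closed rng_inv src_inv inv_mult)
    then have "act A ?\<eta> (act A \<zeta> \<sigma>) = \<tau>"
      using act_mult[OF \<eta>_arrow \<zeta>_arrow \<sigma> src_\<eta> src_\<zeta>] \<tau> by simp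
    moreover have "?\<eta> \<in> src_fibre A (anchor A (act A \<zeta> \<sigma>))"
      using \<eta>_arrow src_\<eta> anchor_act_eq_rng[OF \<zeta> \<sigma>] by (simp add: src_fibre_def)
    ultimately show "\<tau> \<in> limit_set A \<sigma>"
      using act_in_limit_set[OF G \<sigma> L] by metis
  qed
  then have "phase A closure_of orbit A \<sigma> \<subseteq> limit_set A \<sigma>"
    by (rule closure_of_minimal[OF _ closedin_limit_set])
  then show ?thesis
    by (rule subset_antisym[OF limit_set_subset_closure_orbit])
qed

section \<open>Recurrence\<close>

text \<open>
  The net is indexed by the pairs of a compact set of arrows to avoid and a neighbourhood of \<open>\<sigma>\<close>
  to hit, so that its index type depends only on the types of arrows and points.
\<close>

lemma divergent_return_net_if_in_limit_set:
  fixes A :: "('g, 's, 'm) action_data_scheme"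
  assumes "\<sigma> \<in> limit_set A \<sigma>"
  shows "divergent_return_net A \<sigma> TYPE('g set \<times> 's set)"
proof -
  define I where "I = {(K, U). compactin (arrows A) K \<and> openin (phase A) U \<and> \<sigma> \<in> U}"
  define R where "R = {(i, j). i \<in> I \<and> j \<in> I \<and> fst i \<subseteq> fst j \<and> snd j \<subseteq> snd i}"
  have \<sigma>: "\<sigma> \<in> topspace (phase A)"
    using assms by (simp add: in_limit_set_iff)
  have "\<forall>i\<in>I. \<exists>\<xi>. \<xi> \<in> src_fibre A (anchor A \<sigma>) - fst i \<and> act A \<xi> \<sigma> \<in> snd i"
    using assms unfolding in_limit_set_iff I_def by auto
  then obtain \<xi> where \<xi>:
    "\<And>i. i \<in> I \<Longrightarrow> \<xi> i \<in> src_fibre A (anchor A \<sigma>) - fst i \<and> act A (\<xi> i) \<sigma> \<in> snd i"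
    by metis
  have base: "({}, topspace (phase A)) \<in> I"
    using \<sigma> by (simp add: I_def)
  have "\<exists>k\<in>I. (i, k) \<in> R \<and> (j, k) \<in> R" if "i \<in> I" "j \<in> I" for i j
  proof (intro bexI conjI)
    let ?k = "(fst i \<union> fst j, snd i \<inter> snd j)"
    show k: "?k \<in> I"
      using that by (auto simp: I_def compactin_Un)
    show "(i, ?k) \<in> R" "(j, ?k) \<in> R"
      using that k by (auto simp: R_def)
  qed
  moreover have "preorder_on I R"
    by (auto simp: preorder_on_def refl_on_def trans_def R_def)
  ultimately have "directed_set I R"
    using base by (auto simp: directed_set_def)
  moreover have "divergent_net A (anchor A \<sigma>) I R \<xi>"
    unfolding divergent_net_def net_eventually_def
  proof (intro conjI allI impI)
    show "\<xi> ` I \<subseteq> src_fibre A (anchor A \<sigma>)"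
      using \<xi> by auto
    fix K
    assume "K \<subseteq> src_fibre A (anchor A \<sigma>) \<and> compactin (arrows A) K"
    then have "(K, topspace (phase A)) \<in> I"
      using \<sigma> by (simp add: I_def)
    moreover have "\<xi> i \<notin> K" if "i \<in> I" "((K, topspace (phase A)), i) \<in> R" for i
      using \<xi>[OF that(1)] that(2) by (auto simp: R_def)
    ultimately show "\<exists>i\<^sub>0\<in>I. \<forall>i\<in>I. (i\<^sub>0, i) \<in> R \<longrightarrow> \<xi> i \<notin> K"
      by blast
  qed
  moreover have "net_converges (phase A) I R (\<lambda>i. act A (\<xi> i) \<sigma>) \<sigma>"
    unfolding net_converges_def net_eventually_def
  proof (intro conjI allI impI)
    show "\<sigma> \<in> topspace (phase A)"
      by (rule \<sigma>)
    fix U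
    assume "openin (phase A) U \<and> \<sigma> \<in> U"
    then have "({}, U) \<in> I"
      by (simp add: I_def)
    moreover have "act A (\<xi> i) \<sigma> \<in> U" if "i \<in> I" "(({}, U), i) \<in> R" for i
      using \<xi>[OF that(1)] that(2) by (auto simp: R_def)
    ultimately show "\<exists>i\<^sub>0\<in>I. \<forall>i\<in>I. (i\<^sub>0, i) \<in> R \<longrightarrow> act A (\<xi> i) \<sigma> \<in> U"
      by blast
  qed
  ultimately show ?thesis
    unfolding divergent_return_net_def by blast
qed

lemma net_eventually_conj_ex:
  assumes "directed_set I R" and "net_eventually I R P" and "net_eventually I R Q"
  shows "\<exists>i\<in>I. P i \<and> Q i"
  using assms unfolding directed_set_def net_eventually_def by meson

lemma (in continuous_groupoid_action) return_set_not_relatively_compactin: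
  assumes "divergent_return_net A \<sigma> TYPE('i)"
    and U: "openin (phase A) U" "\<sigma> \<in> U"
  shows "\<not> relatively_compactin (arrows A) (return_set A \<sigma> U)"
proof
  let ?K = "arrows A closure_of return_set A \<sigma> U"
  assume "relatively_compactin (arrows A) (return_set A \<sigma> U)"
  then have K: "compactin (arrows A) ?K" and sub: "return_set A \<sigma> U \<subseteq> ?K"
    by (auto simp: relatively_compactin_def closure_of_subset)
  obtain I :: "'i set" and R \<xi> where dir: "directed_set I R"
    and div: "divergent_net A (anchor A \<sigma>) I R \<xi>"
    and conv: "net_converges (phase A) I R (\<lambda>i. act A (\<xi> i) \<sigma>) \<sigma>"
    using assms(1) unfolding divergent_return_net_def by blast
  have \<sigma>: "\<sigma> \<in> topspace (phase A)"
    using U openin_subset by blast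
  have "?K \<subseteq> src_fibre A (anchor A \<sigma>)"
    by (rule closure_of_minimal)
      (auto simp: return_set_def closedin_src_fibre anchor_in_arrows \<sigma>)
  then have "net_eventually I R (\<lambda>i. \<xi> i \<notin> ?K)"
    using div K by (simp add: divergent_net_def)
  moreover have "net_eventually I R (\<lambda>i. act A (\<xi> i) \<sigma> \<in> U)"
    using conv U by (simp add: net_converges_def)
  ultimately obtain i where "i \<in> I" "\<xi> i \<notin> ?K" "act A (\<xi> i) \<sigma> \<in> U"
    using net_eventually_conj_ex[OF dir] by blast
  moreover have "\<xi> i \<in> src_fibre A (anchor A \<sigma>)"
    using div \<open>i \<in> I\<close> by (auto simp: divergent_net_def)
  ultimately show False
    using sub by (auto simp: return_set_def)
qed

lemma (in continuous_groupoid_action) in_limit_set_if_return_sets_not_relatively_compactin: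
  assumes \<sigma>: "\<sigma> \<in> topspace (phase A)"
    and returns: "\<And>U. openin (phase A) U \<Longrightarrow> \<sigma> \<in> U
      \<Longrightarrow> \<not> relatively_compactin (arrows A) (return_set A \<sigma> U)"
  shows "\<sigma> \<in> limit_set A \<sigma>"
  unfolding in_limit_set_iff
proof (intro conjI allI impI)
  show "\<sigma> \<in> topspace (phase A)"
    by (rule \<sigma>)
  fix K U
  assume KU: "compactin (arrows A) K \<and> openin (phase A) U \<and> \<sigma> \<in> U"
  have "\<not> return_set A \<sigma> U \<subseteq> K"
  proof
    assume "return_set A \<sigma> U \<subseteq> K"
    moreover have "closedin (arrows A) K"
      using KU Hausdorff_arrows by (simp add: compactin_imp_closedin)
    ultimately have "arrows A closure_of return_set A \<sigma> U \<subseteq> K"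
      by (rule closure_of_minimal)
    then have "compactin (arrows A) (arrows A closure_of return_set A \<sigma> U)"
      using KU by (meson closed_compactin closedin_closure_of)
    moreover have "return_set A \<sigma> U \<subseteq> topspace (arrows A)"
      by (auto simp: return_set_def src_fibre_def)
    ultimately show False
      using returns KU by (auto simp: relatively_compactin_def)
  qed
  then show "\<exists>\<xi>\<in>src_fibre A (anchor A \<sigma>) - K. act A \<xi> \<sigma> \<in> U"
    by (auto simp: return_set_def)
qed

theorem proposition5p8:
  fixes A :: "('g, 's) action_data" and \<sigma> :: 's
  assumes "continuous_groupoid_action A"
    and "strongly_noncompact A"
    and "\<sigma> \<in> topspace (phase A)"
  defines "cond_a \<equiv> orbit A \<sigma> \<inter> limit_set A \<sigma> \<noteq> {}"
    and "cond_b \<equiv> limit_set A \<sigma> = phase A closure_of orbit A \<sigma>"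
    and "cond_c \<equiv> \<sigma> \<in> limit_set A \<sigma>"
    and "cond_d \<equiv> divergent_return_net A \<sigma> TYPE('g set \<times> 's set)"
    and "cond_d_any \<equiv> divergent_return_net A \<sigma> TYPE('i)"
    and "cond_e \<equiv> \<forall>U. openin (phase A) U \<and> \<sigma> \<in> U
                      \<longrightarrow> \<not> relatively_compactin (arrows A) (return_set A \<sigma> U)"
  shows "(cond_b \<longrightarrow> cond_c) \<and> (cond_c \<longleftrightarrow> cond_d) \<and> (cond_d \<longleftrightarrow> cond_e) \<and> (cond_e \<longrightarrow> cond_a)
    \<and> (cond_d_any \<longrightarrow> cond_d)
    \<and> (open_groupoid A \<and> locally_compact_space (arrows A) \<longrightarrow>
        (cond_a \<longleftrightarrow> cond_b) \<and> (cond_b \<longleftrightarrow> cond_c) \<and> (cond_c \<longleftrightarrow> cond_d) \<and> (cond_d \<longleftrightarrow> cond_e))"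
proof -
  interpret continuous_groupoid_action A
    by fact
  note \<sigma> = \<open>\<sigma> \<in> topspace (phase A)\<close>
  have orb: "\<sigma> \<in> orbit A \<sigma>"
    using self_in_orbit[OF \<sigma>] .
  then have b_c: "cond_b \<Longrightarrow> cond_c"
    unfolding cond_b_def cond_c_def using \<sigma> by (auto simp: in_closure_of)
  have c_d: "cond_c \<Longrightarrow> cond_d"
    unfolding cond_c_def cond_d_def by (rule divergent_return_net_if_in_limit_set)
  have d_e: "cond_d \<Longrightarrow> cond_e" and any_e: "cond_d_any \<Longrightarrow> cond_e"
    unfolding cond_d_def cond_d_any_def cond_e_def
    using return_set_not_relatively_compactin by blast+
  have e_c: "cond_e \<Longrightarrow> cond_c"
    unfolding cond_e_def cond_c_def
    using in_limit_set_if_return_sets_not_relatively_compactin[OF \<sigma>] by blast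
  have c_a: "cond_c \<Longrightarrow> cond_a"
    unfolding cond_c_def cond_a_def using orb by blast
  have a_b: "cond_b" if "open_groupoid A" "locally_compact_space (arrows A)" "cond_a"
    using limit_set_eq_closure_orbit[OF that(1,2) \<sigma>] that(3)
    unfolding cond_a_def cond_b_def by blast
  show ?thesis
    using b_c c_d d_e any_e e_c c_a a_b by blast
qed

end
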